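(* Let $G=(\mathbb{Z}/p\mathbb{Z})^n$ for some prime $p$ and integer $n\geq 1$. If $\varphi\in\operatorname{Aut}(G)$ is multiplication by a non-trivial unit of $\mathbb{Z}/p\mathbb{Z}$ (i.e. a unit different from $1$), then $\operatorname{Aut}(\operatorname{Alex}(G,\varphi))$ acts doubly transitively on $\operatorname{Alex}(G,\varphi)$.
   Context: A quandle is a set $X$ with a binary operation $*$ such that: (i) $a*a=a$ for all $a\in X$; (ii) for any $a,b\in X$ there is a unique $c\in X$ with $a=c*b$; (iii) $(a*b)*c=(a*c)*(b*c)$ for all $a,b,c\in X$. An automorphism of a quandle $X$ is a bijection $f:X\to X$ with $f(a*b)=f(a)*f(b)$; these form the group $\operatorname{Aut}(X)$ under composition, which acts on $X$ by $(f,x)\mapsto f(x)$. For an additive abelian group $G$ and a group automorphism $\varphi\in\operatorname{Aut}(G)$, the Alexander quandle $\operatorname{Alex}(G,\varphi)$ is the set $G$ with operation $a*b=\varphi(a)-\varphi(b)+b$. A group $H$ acting on a set $X$ acts doubly transitively if for any two pairs $(x_1,x_2)$ and $(y_1,y_2)$ of distinct elements of $X$ (i.e. $x_1\neq x_2$ and $y_1\neq y_2$) there is $g\in H$ with $gx_1=y_1$ and $gx_2=y_2$. *)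

theory Defs
  imports "HOL-Algebra.Product_Groups" "HOL-Algebra.Group_Action" "HOL-Number_Theory.Residues"
begin

record 'a quandle = "'a partial_object" +
  qop :: "'a \<Rightarrow> 'a \<Rightarrow> 'a"  (infixl \<open>\<star>\<index>\<close> 70)

locale quandle =
  fixes X (structure)
  assumes op_closed: "\<lbrakk>a \<in> carrier X; b \<in> carrier X\<rbrakk> \<Longrightarrow> a \<star> b \<in> carrier X"
    and idem: "a \<in> carrier X \<Longrightarrow> a \<star> a = a"
    and right_div: "\<lbrakk>a \<in> carrier X; b \<in> carrier X\<rbrakk> \<Longrightarrow> \<exists>!c. c \<in> carrier X \<and> a = c \<star> b"
    and right_distrib: "\<lbrakk>a \<in> carrier X; b \<in> carrier X; c \<in> carrier X\<rbrakk>
      \<Longrightarrow> (a \<star> b) \<star> c = (a \<star> c) \<star> (b \<star> c)"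

definition quandle_auto :: "('a, 'm) quandle_scheme \<Rightarrow> ('a \<Rightarrow> 'a) set"
  where "quandle_auto X =
    {f \<in> Bij (carrier X). \<forall>a\<in>carrier X. \<forall>b\<in>carrier X. f (a \<star>\<^bsub>X\<^esub> b) = f a \<star>\<^bsub>X\<^esub> f b}"

definition QuandleAutoGroup :: "('a, 'm) quandle_scheme \<Rightarrow> ('a \<Rightarrow> 'a) monoid"
  where "QuandleAutoGroup X = BijGroup (carrier X) \<lparr>carrier := quandle_auto X\<rparr>"

text \<open>The group \<open>G\<close> is written multiplicatively, as everywhere in HOL-Algebra; in additive
  notation the operation below is \<open>a * b = \<phi>(a) - \<phi>(b) + b\<close>.\<close>

definition Alex :: "('a, 'm) monoid_scheme \<Rightarrow> ('a \<Rightarrow> 'a) \<Rightarrow> 'a quandle"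
  where "Alex G \<phi> = \<lparr>carrier = carrier G,
    qop = (\<lambda>a b. \<phi> a \<otimes>\<^bsub>G\<^esub> inv\<^bsub>G\<^esub> \<phi> b \<otimes>\<^bsub>G\<^esub> b)\<rparr>"

locale doubly_transitive_action = group_action +
  assumes doubly_transitive:
    "\<lbrakk>x1 \<in> E; x2 \<in> E; y1 \<in> E; y2 \<in> E; x1 \<noteq> x2; y1 \<noteq> y2\<rbrakk>
      \<Longrightarrow> \<exists>g \<in> carrier G. \<phi> g x1 = y1 \<and> \<phi> g x2 = y2"

text \<open>The additive group of \<open>(\<int>/p\<int>)\<^sup>n\<close>; its elements are the extensional functions
  from \<open>{..<n}\<close> to \<open>{0..p - 1}\<close>.\<close>

definition Zmod_power :: "nat \<Rightarrow> nat \<Rightarrow> (nat \<Rightarrow> int) monoid"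
  where "Zmod_power p n = product_group {..<n} (\<lambda>_. add_monoid (residue_ring (int p)))"


lemma (in quandle) subgroup_quandle_auto:
  "subgroup (quandle_auto X) (BijGroup (carrier X))"
proof (rule group.subgroupI[OF group_BijGroup])
  show "quandle_auto X \<subseteq> carrier (BijGroup (carrier X))"
    by (auto simp: quandle_auto_def BijGroup_def)
  have "(\<lambda>x\<in>carrier X. x) \<in> quandle_auto X"
    by (auto simp: quandle_auto_def id_Bij op_closed)
  then show "quandle_auto X \<noteq> {}" by blast
next
  fix f assume f: "f \<in> quandle_auto X"
  then have B: "f \<in> Bij (carrier X)" by (simp add: quandle_auto_def)
  have "inv_into (carrier X) f (a \<star> b) = inv_into (carrier X) f a \<star> inv_into (carrier X) f b"
    if "a \<in> carrier X" "b \<in> carrier X" for a b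
    by (rule Bij_inv_into_lemma[OF _ B]) (use f that op_closed in \<open>auto simp: quandle_auto_def\<close>)
  then show "inv\<^bsub>BijGroup (carrier X)\<^esub> f \<in> quandle_auto X"
    using B by (auto simp: quandle_auto_def inv_BijGroup restrict_inv_into_Bij op_closed)
next
  fix f g assume "f \<in> quandle_auto X" "g \<in> quandle_auto X"
  then show "f \<otimes>\<^bsub>BijGroup (carrier X)\<^esub> g \<in> quandle_auto X"
    using Bij_imp_funcset[of g "carrier X"]
    by (auto simp: quandle_auto_def BijGroup_def compose_Bij compose_eq op_closed Pi_iff)
qed

lemma (in quandle) group_action_quandle_auto:
  "group_action (QuandleAutoGroup X) (carrier X) (\<lambda>f. f)"
proof -
  interpret S: subgroup "quandle_auto X" "BijGroup (carrier X)"
    by (rule subgroup_quandle_auto)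
  have "group (QuandleAutoGroup X)"
    unfolding QuandleAutoGroup_def by (rule S.subgroup_is_group[OF group_BijGroup])
  then show ?thesis
    using S.subset
    by (auto simp: group_action_def group_hom_def group_hom_axioms_def group_BijGroup
        hom_def QuandleAutoGroup_def)
qed

lemma quandle_Alex:
  assumes "comm_group G" and phi: "\<phi> \<in> auto G"
  shows "quandle (Alex G \<phi>)"
proof -
  interpret comm_group G by fact
  have cl [simp]: "\<phi> x \<in> carrier G" if "x \<in> carrier G" for x
    using phi that by (auto simp: auto_def hom_def)
  have mu: "\<phi> (x \<otimes>\<^bsub>G\<^esub> y) = \<phi> x \<otimes>\<^bsub>G\<^esub> \<phi> y" if "x \<in> carrier G" "y \<in> carrier G" for x y
    using phi that by (auto simp: auto_def hom_def)
  interpret h: group_hom G G \<phi>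
    using phi by unfold_locales (auto simp: auto_def)
  have bij: "bij_betw \<phi> (carrier G) (carrier G)"
    using phi by (auto simp: auto_def Bij_def)
  have op: "a \<star>\<^bsub>Alex G \<phi>\<^esub> b = \<phi> a \<otimes>\<^bsub>G\<^esub> inv\<^bsub>G\<^esub> \<phi> b \<otimes>\<^bsub>G\<^esub> b" for a b
    by (simp add: Alex_def)
  have car: "carrier (Alex G \<phi>) = carrier G"
    by (simp add: Alex_def)
  have cancel: "x \<otimes>\<^bsub>G\<^esub> (inv\<^bsub>G\<^esub> x \<otimes>\<^bsub>G\<^esub> y) = y" "inv\<^bsub>G\<^esub> x \<otimes>\<^bsub>G\<^esub> (x \<otimes>\<^bsub>G\<^esub> y) = y"
    if "x \<in> carrier G" "y \<in> carrier G" for x y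
    using that by (simp_all flip: m_assoc)
  have key: "k \<otimes>\<^bsub>G\<^esub> (x \<otimes>\<^bsub>G\<^esub> (l \<otimes>\<^bsub>G\<^esub> (inv\<^bsub>G\<^esub> k \<otimes>\<^bsub>G\<^esub> (inv\<^bsub>G\<^esub> k \<otimes>\<^bsub>G\<^esub> (y \<otimes>\<^bsub>G\<^esub> inv\<^bsub>G\<^esub> l))))) = x \<otimes>\<^bsub>G\<^esub> (inv\<^bsub>G\<^esub> k \<otimes>\<^bsub>G\<^esub> y)"
    if "k \<in> carrier G" "l \<in> carrier G" "x \<in> carrier G" "y \<in> carrier G" for k l x y
  proof -
    have "k \<otimes>\<^bsub>G\<^esub> (x \<otimes>\<^bsub>G\<^esub> (l \<otimes>\<^bsub>G\<^esub> (inv\<^bsub>G\<^esub> k \<otimes>\<^bsub>G\<^esub> (inv\<^bsub>G\<^esub> k \<otimes>\<^bsub>G\<^esub> (y \<otimes>\<^bsub>G\<^esub> inv\<^bsub>G\<^esub> l))))) = k \<otimes>\<^bsub>G\<^esub> (inv\<^bsub>G\<^esub> k \<otimes>\<^bsub>G\<^esub> (l \<otimes>\<^bsub>G\<^esub> (inv\<^bsub>G\<^esub> l \<otimes>\<^bsub>G\<^esub> (x \<otimes>\<^bsub>G\<^esub> (inv\<^bsub>G\<^esub> k \<otimes>\<^bsub>G\<^esub> y)))))"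
      using that by (simp add: m_ac)
    also have "\<dots> = x \<otimes>\<^bsub>G\<^esub> (inv\<^bsub>G\<^esub> k \<otimes>\<^bsub>G\<^esub> y)"
      using that by (simp add: cancel)
    finally show ?thesis .
  qed
  show ?thesis
  proof (unfold_locales, unfold car op)
    fix a b assume ab: "a \<in> carrier G" "b \<in> carrier G"
    have "\<exists>c. c \<in> carrier G \<and> \<phi> c = a \<otimes>\<^bsub>G\<^esub> inv\<^bsub>G\<^esub> b \<otimes>\<^bsub>G\<^esub> \<phi> b"
      using bij_betw_imp_surj_on[OF bij] ab by (metis cl image_iff inv_closed m_closed)
    then obtain c where c: "c \<in> carrier G" "\<phi> c = a \<otimes>\<^bsub>G\<^esub> inv\<^bsub>G\<^esub> b \<otimes>\<^bsub>G\<^esub> \<phi> b"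
      by blast
    show "\<exists>!c. c \<in> carrier G \<and> a = \<phi> c \<otimes>\<^bsub>G\<^esub> inv\<^bsub>G\<^esub> \<phi> b \<otimes>\<^bsub>G\<^esub> b"
    proof (rule ex1I[of _ c])
      show "c \<in> carrier G \<and> a = \<phi> c \<otimes>\<^bsub>G\<^esub> inv\<^bsub>G\<^esub> \<phi> b \<otimes>\<^bsub>G\<^esub> b"
        using c ab by (simp add: m_assoc cancel del: h.hom_inv)
      fix d assume d: "d \<in> carrier G \<and> a = \<phi> d \<otimes>\<^bsub>G\<^esub> inv\<^bsub>G\<^esub> \<phi> b \<otimes>\<^bsub>G\<^esub> b"
      have "\<phi> d = a \<otimes>\<^bsub>G\<^esub> inv\<^bsub>G\<^esub> b \<otimes>\<^bsub>G\<^esub> \<phi> b"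
        using d ab by (simp add: m_assoc cancel del: h.hom_inv)
      then show "d = c"
        using c d bij_betw_imp_inj_on[OF bij] by (auto dest: inj_onD)
    qed
  next
    fix a b c assume "a \<in> carrier G" "b \<in> carrier G" "c \<in> carrier G"
    then show "\<phi> (\<phi> a \<otimes>\<^bsub>G\<^esub> inv\<^bsub>G\<^esub> \<phi> b \<otimes>\<^bsub>G\<^esub> b) \<otimes>\<^bsub>G\<^esub> inv\<^bsub>G\<^esub> \<phi> c \<otimes>\<^bsub>G\<^esub> c =
      \<phi> (\<phi> a \<otimes>\<^bsub>G\<^esub> inv\<^bsub>G\<^esub> \<phi> c \<otimes>\<^bsub>G\<^esub> c) \<otimes>\<^bsub>G\<^esub> inv\<^bsub>G\<^esub> \<phi> (\<phi> b \<otimes>\<^bsub>G\<^esub> inv\<^bsub>G\<^esub> \<phi> c \<otimes>\<^bsub>G\<^esub> c)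
        \<otimes>\<^bsub>G\<^esub> (\<phi> b \<otimes>\<^bsub>G\<^esub> inv\<^bsub>G\<^esub> \<phi> c \<otimes>\<^bsub>G\<^esub> c)"
      by (simp add: inv_mult cancel key m_ac)
  qed auto
qed

end

theory Submission
  imports Defs
begin

text \<open>
  Let \<open>G\<close> be abelian and \<open>\<phi>\<close> an automorphism of \<open>G\<close>. Every affine map \<open>x \<mapsto> \<psi>(x) + c\<close>, where
  the automorphism \<open>\<psi>\<close> commutes with \<open>\<phi>\<close>, is an automorphism of \<open>Alex(G, \<phi>)\<close>. The translations
  move any point to any other, so double transitivity reduces to a linear question: whether the
  centralizer of \<open>\<phi>\<close> in \<open>Aut(G)\<close> is transitive on \<open>G - {0}\<close>. This reduction is
  \<open>doubly_transitive_if_centralizer_transitive\<close>.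

  When \<open>G = (\<int>/p\<int>)\<^sup>n\<close> and \<open>\<phi>\<close> is a scalar, every linear map commutes with \<open>\<phi>\<close>, so what remains
  is that \<open>GL(n, p)\<close> is transitive on nonzero vectors. No basis extension is needed for this:
  given nonzero \<open>v\<close> and \<open>w\<close>, choose a linear form \<open>f\<close> with \<open>f(v)\<close> and \<open>f(w)\<close> both nonzero. Then
  \<open>x \<mapsto> x + f(x) f(v)\<^sup>-\<^sup>1 (w - v)\<close>
  sends \<open>v\<close> to \<open>w\<close>, and exchanging \<open>v\<close> and \<open>w\<close> in the formula gives its inverse. A sum of one or
  two coordinates suffices for \<open>f\<close> (\<open>coordinate_sum_nonzero_at_both\<close>).
\<close>

section \<open>Affine automorphisms of Alexander quandles\<close>

text \<open>The translation part cancels because \<open>\<phi>(c) - \<phi>(c) + c = c\<close>; the linear part passes through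
  the operation because it commutes with \<open>\<phi>\<close>.\<close>

lemma affine_quandle_auto_Alex:
  assumes "comm_group G" and phi: "\<phi> \<in> auto G" and psi: "\<psi> \<in> auto G"
    and comm: "\<And>x. x \<in> carrier G \<Longrightarrow> \<psi> (\<phi> x) = \<phi> (\<psi> x)"
    and c: "c \<in> carrier G"
  shows "(\<lambda>x\<in>carrier G. \<psi> x \<otimes>\<^bsub>G\<^esub> c) \<in> quandle_auto (Alex G \<phi>)"
proof -
  interpret comm_group G by fact
  interpret f: group_hom G G \<phi>
    using phi by unfold_locales (auto simp: auto_def)
  interpret s: group_hom G G \<psi>
    using psi by unfold_locales (auto simp: auto_def)
  let ?g = "\<lambda>x\<in>carrier G. \<psi> x \<otimes>\<^bsub>G\<^esub> c"
  have bij: "bij_betw \<psi> (carrier G) (carrier G)"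
    using psi by (auto simp: auto_def Bij_def)
  have tr: "bij_betw (\<lambda>x. x \<otimes>\<^bsub>G\<^esub> c) (carrier G) (carrier G)"
    by (rule bij_betw_byWitness[where f' = "\<lambda>x. x \<otimes>\<^bsub>G\<^esub> inv\<^bsub>G\<^esub> c"]) (use c in \<open>auto simp: m_assoc\<close>)
  have "bij_betw ?g (carrier G) (carrier G)"
    using bij_betw_trans[OF bij tr] by (auto simp: o_def cong: bij_betw_cong)
  then have "?g \<in> Bij (carrier G)"
    by (simp add: Bij_def)
  moreover have "?g (\<phi> a \<otimes>\<^bsub>G\<^esub> inv\<^bsub>G\<^esub> \<phi> b \<otimes>\<^bsub>G\<^esub> b) = \<phi> (?g a) \<otimes>\<^bsub>G\<^esub> inv\<^bsub>G\<^esub> \<phi> (?g b) \<otimes>\<^bsub>G\<^esub> ?g b"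
    if ab: "a \<in> carrier G" "b \<in> carrier G" for a b
  proof -
    have "\<phi> c \<otimes>\<^bsub>G\<^esub> (inv\<^bsub>G\<^esub> \<phi> c \<otimes>\<^bsub>G\<^esub> inv\<^bsub>G\<^esub> \<phi> (\<psi> b)) = inv\<^bsub>G\<^esub> \<phi> (\<psi> b)"
      using ab c by (simp flip: m_assoc del: f.hom_inv)
    then have cancel: "\<phi> (?g a) \<otimes>\<^bsub>G\<^esub> inv\<^bsub>G\<^esub> \<phi> (?g b) = \<phi> (\<psi> a) \<otimes>\<^bsub>G\<^esub> inv\<^bsub>G\<^esub> \<phi> (\<psi> b)"
      using ab c by (simp add: m_assoc inv_mult_group del: f.hom_inv)
    have "?g (\<phi> a \<otimes>\<^bsub>G\<^esub> inv\<^bsub>G\<^esub> \<phi> b \<otimes>\<^bsub>G\<^esub> b) = \<phi> (\<psi> a) \<otimes>\<^bsub>G\<^esub> inv\<^bsub>G\<^esub> \<phi> (\<psi> b) \<otimes>\<^bsub>G\<^esub> \<psi> b \<otimes>\<^bsub>G\<^esub> c"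
      using ab c comm by (simp flip: f.hom_inv s.hom_inv)
    also have "\<dots> = \<phi> (\<psi> a) \<otimes>\<^bsub>G\<^esub> inv\<^bsub>G\<^esub> \<phi> (\<psi> b) \<otimes>\<^bsub>G\<^esub> ?g b"
      using ab c by (simp add: m_assoc del: f.hom_inv)
    also have "\<dots> = \<phi> (?g a) \<otimes>\<^bsub>G\<^esub> inv\<^bsub>G\<^esub> \<phi> (?g b) \<otimes>\<^bsub>G\<^esub> ?g b"
      by (simp only: cancel)
    finally show ?thesis .
  qed
  ultimately show ?thesis
    by (auto simp: quandle_auto_def Alex_def)
qed

text \<open>To carry \<open>(x1, x2)\<close> to \<open>(y1, y2)\<close>, choose \<open>\<psi>\<close> in the centralizer of \<open>\<phi>\<close> with
  \<open>\<psi>(x2 - x1) = y2 - y1\<close> and then translate \<open>\<psi>(x1)\<close> to \<open>y1\<close>.\<close>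

lemma doubly_transitive_if_centralizer_transitive:
  assumes G: "comm_group G" and phi: "\<phi> \<in> auto G"
    and trans: "\<And>v w. \<lbrakk>v \<in> carrier G; w \<in> carrier G; v \<noteq> \<one>\<^bsub>G\<^esub>; w \<noteq> \<one>\<^bsub>G\<^esub>\<rbrakk> \<Longrightarrow>
      \<exists>\<psi>\<in>auto G. (\<forall>x\<in>carrier G. \<psi> (\<phi> x) = \<phi> (\<psi> x)) \<and> \<psi> v = w"
  shows "doubly_transitive_action (QuandleAutoGroup (Alex G \<phi>)) (carrier (Alex G \<phi>)) (\<lambda>f. f)"
proof -
  interpret comm_group G by fact
  interpret Q: quandle "Alex G \<phi>"
    by (rule quandle_Alex[OF G phi])
  have "\<exists>g\<in>quandle_auto (Alex G \<phi>). g x1 = y1 \<and> g x2 = y2"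
    if el: "x1 \<in> carrier G" "x2 \<in> carrier G" "y1 \<in> carrier G" "y2 \<in> carrier G"
      and ne: "x1 \<noteq> x2" "y1 \<noteq> y2" for x1 x2 y1 y2
  proof -
    have "x2 \<otimes>\<^bsub>G\<^esub> inv\<^bsub>G\<^esub> x1 \<noteq> \<one>\<^bsub>G\<^esub>" "y2 \<otimes>\<^bsub>G\<^esub> inv\<^bsub>G\<^esub> y1 \<noteq> \<one>\<^bsub>G\<^esub>"
      using el ne by (metis inv_solve_right' l_one one_closed)+
    then obtain \<psi> where psi: "\<psi> \<in> auto G" and comm: "\<And>x. x \<in> carrier G \<Longrightarrow> \<psi> (\<phi> x) = \<phi> (\<psi> x)"
      and eq: "\<psi> (x2 \<otimes>\<^bsub>G\<^esub> inv\<^bsub>G\<^esub> x1) = y2 \<otimes>\<^bsub>G\<^esub> inv\<^bsub>G\<^esub> y1"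
      using trans[of "x2 \<otimes>\<^bsub>G\<^esub> inv\<^bsub>G\<^esub> x1" "y2 \<otimes>\<^bsub>G\<^esub> inv\<^bsub>G\<^esub> y1"] el by auto
    interpret s: group_hom G G \<psi>
      using psi by unfold_locales (auto simp: auto_def)
    define c where "c = inv\<^bsub>G\<^esub> \<psi> x1 \<otimes>\<^bsub>G\<^esub> y1"
    have c: "c \<in> carrier G"
      using el by (simp add: c_def del: s.hom_inv)
    have "\<psi> x1 \<otimes>\<^bsub>G\<^esub> c = y1"
      using el by (simp add: c_def m_assoc[symmetric] del: s.hom_inv)
    moreover have "\<psi> x2 \<otimes>\<^bsub>G\<^esub> c = y2"
    proof -
      have "\<psi> x2 \<otimes>\<^bsub>G\<^esub> c = \<psi> (x2 \<otimes>\<^bsub>G\<^esub> inv\<^bsub>G\<^esub> x1) \<otimes>\<^bsub>G\<^esub> y1"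
        using el by (simp add: c_def m_assoc)
      also have "\<dots> = y2"
        using el by (simp add: eq m_assoc)
      finally show ?thesis .
    qed
    ultimately show ?thesis
      using affine_quandle_auto_Alex[OF G phi psi comm c] el
      by (intro bexI[where x = "\<lambda>x\<in>carrier G. \<psi> x \<otimes>\<^bsub>G\<^esub> c"]) simp_all
  qed
  then show ?thesis
    using Q.group_action_quandle_auto
    by (auto simp: doubly_transitive_action_def doubly_transitive_action_axioms_def
        QuandleAutoGroup_def Alex_def)
qed

section \<open>Linear maps on the group of residue vectors\<close>

lemma carrier_Zmod_power:
  "carrier (Zmod_power p n) = {..<n} \<rightarrow>\<^sub>E {0..int p - 1}"
  by (simp add: Zmod_power_def residue_ring_def)

lemma mult_Zmod_power:
  "x \<otimes>\<^bsub>Zmod_power p n\<^esub> y = (\<lambda>i\<in>{..<n}. (x i + y i) mod int p)"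
  by (simp add: Zmod_power_def residue_ring_def)

lemma one_Zmod_power: "\<one>\<^bsub>Zmod_power p n\<^esub> = (\<lambda>i\<in>{..<n}. 0)"
  by (simp add: Zmod_power_def residue_ring_def)

lemma comm_group_Zmod_power:
  assumes "p > 1"
  shows "comm_group (Zmod_power p n)"
proof -
  interpret residues "int p" "residue_ring (int p)"
    using assms by unfold_locales simp_all
  have "group (Zmod_power p n)"
    unfolding Zmod_power_def by (intro product_group a_group)
  then show ?thesis
    by (rule group.group_comm_groupI) (auto simp: mult_Zmod_power add.commute)
qed

lemma Zmod_power_mod:
  assumes "x \<in> carrier (Zmod_power p n)" and "i < n"
  shows "x i mod int p = x i"
  using assms by (auto simp: carrier_Zmod_power PiE_iff)

text \<open>For a support \<open>S\<close>, this is \<open>x \<mapsto> x + k f(x) d\<close> with the linear form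
  \<open>f(x) = \<Sum>\<^sub>j\<^sub>\<in>\<^sub>S x\<^sub>j\<close>: the identity plus a linear map whose image lies on the line
  through \<open>d\<close>.\<close>

definition rank_one_update ::
    "nat \<Rightarrow> nat \<Rightarrow> nat set \<Rightarrow> int \<Rightarrow> (nat \<Rightarrow> int) \<Rightarrow> (nat \<Rightarrow> int) \<Rightarrow> (nat \<Rightarrow> int)"
  where "rank_one_update p n S k d =
    (\<lambda>x\<in>carrier (Zmod_power p n). \<lambda>i\<in>{..<n}. (x i + k * sum x S * d i) mod int p)"

lemma rank_one_update_closed:
  assumes "p > 1" and "x \<in> carrier (Zmod_power p n)"
  shows "rank_one_update p n S k d x \<in> carrier (Zmod_power p n)"
  using assms by (auto simp: rank_one_update_def carrier_Zmod_power)

lemma cong_sum_restrict_mod: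
  fixes g :: "nat \<Rightarrow> int"
  assumes "S \<subseteq> {..<n}"
  shows "[sum (\<lambda>i\<in>{..<n}. g i mod m) S = sum g S] (mod m)"
  using assms by (intro cong_sum) (auto simp: cong_def)

lemma rank_one_update_hom:
  assumes "p > 1" and S: "S \<subseteq> {..<n}"
  shows "rank_one_update p n S k d \<in> hom (Zmod_power p n) (Zmod_power p n)"
proof (rule homI)
  fix x y assume x: "x \<in> carrier (Zmod_power p n)" and y: "y \<in> carrier (Zmod_power p n)"
  interpret comm_group "Zmod_power p n"
    by (rule comm_group_Zmod_power[OF assms(1)])
  let ?m = "int p" and ?xy = "\<lambda>i\<in>{..<n}. (x i + y i) mod int p"
  have xy: "?xy \<in> carrier (Zmod_power p n)"
    using m_closed[OF x y] by (simp add: mult_Zmod_power)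
  have f: "[sum ?xy S = sum x S + sum y S] (mod ?m)"
    using cong_sum_restrict_mod[OF S, of "\<lambda>i. x i + y i" ?m] by (simp add: sum.distrib)
  have "[?xy i + k * sum ?xy S * d i
      = (x i + k * sum x S * d i) mod ?m + (y i + k * sum y S * d i) mod ?m] (mod ?m)"
    if "i < n" for i
  proof -
    have "[?xy i + k * sum ?xy S * d i = (x i + y i) + k * (sum x S + sum y S) * d i] (mod ?m)"
      using that by (intro cong_add cong_mult f cong_refl) (simp add: cong_def)
    moreover have "[(x i + k * sum x S * d i) mod ?m + (y i + k * sum y S * d i) mod ?m
        = (x i + k * sum x S * d i) + (y i + k * sum y S * d i)] (mod ?m)"
      by (intro cong_add) (simp_all add: cong_def)
    ultimately show ?thesis
      by (simp add: cong_def algebra_simps)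
  qed
  then show "rank_one_update p n S k d (x \<otimes>\<^bsub>Zmod_power p n\<^esub> y) =
      rank_one_update p n S k d x \<otimes>\<^bsub>Zmod_power p n\<^esub> rank_one_update p n S k d y"
    using x y xy by (intro ext) (simp add: rank_one_update_def mult_Zmod_power cong_def)
qed (rule rank_one_update_closed[OF assms(1)])

lemma rank_one_update_scalar:
  assumes S: "S \<subseteq> {..<n}" and x: "x \<in> carrier (Zmod_power p n)"
    and ux: "(\<lambda>i\<in>{..<n}. (u * x i) mod int p) \<in> carrier (Zmod_power p n)"
  shows "rank_one_update p n S k d (\<lambda>i\<in>{..<n}. (u * x i) mod int p)
    = (\<lambda>i\<in>{..<n}. (u * rank_one_update p n S k d x i) mod int p)"
proof -
  let ?m = "int p" and ?ux = "\<lambda>i\<in>{..<n}. (u * x i) mod int p"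
  have f: "[sum ?ux S = u * sum x S] (mod ?m)"
    using cong_sum_restrict_mod[OF S, of "\<lambda>i. u * x i" ?m] by (simp add: sum_distrib_left)
  have "[?ux i + k * sum ?ux S * d i = u * ((x i + k * sum x S * d i) mod ?m)] (mod ?m)"
    if "i < n" for i
  proof -
    have "[?ux i + k * sum ?ux S * d i = u * x i + k * (u * sum x S) * d i] (mod ?m)"
      using that by (intro cong_add cong_mult f cong_refl) (simp add: cong_def)
    moreover have "[u * ((x i + k * sum x S * d i) mod ?m) = u * (x i + k * sum x S * d i)] (mod ?m)"
      by (intro cong_mult cong_refl) (simp add: cong_def)
    ultimately show ?thesis
      by (simp add: cong_def algebra_simps)
  qed
  then show ?thesis
    using x ux by (intro ext) (simp add: rank_one_update_def cong_def)
qed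

text \<open>Write \<open>f\<close> for the sum over \<open>S\<close> and \<open>T\<close> for the update with \<open>k = f(v)\<^sup>-\<^sup>1\<close>. Since
  \<open>f(T(x)) = f(x) f(v)\<^sup>-\<^sup>1 f(w)\<close>, the reverse update subtracts exactly the multiple of
  \<open>w - v\<close> that \<open>T\<close> added.\<close>

lemma rank_one_update_inverse:
  assumes "p > 1" and S: "S \<subseteq> {..<n}" and x: "x \<in> carrier (Zmod_power p n)"
    and k: "[k * sum v S = 1] (mod int p)" and l: "[l * sum w S = 1] (mod int p)"
  shows "rank_one_update p n S l (\<lambda>i. v i - w i)
    (rank_one_update p n S k (\<lambda>i. w i - v i) x) = x"
proof -
  let ?m = "int p" and ?y = "rank_one_update p n S k (\<lambda>i. w i - v i) x"
  have y: "?y \<in> carrier (Zmod_power p n)"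
    by (rule rank_one_update_closed[OF assms(1) x])
  have "[sum ?y S = (\<Sum>i\<in>S. x i + k * sum x S * (w i - v i))] (mod ?m)"
    using x cong_sum_restrict_mod[OF S] by (simp add: rank_one_update_def)
  also have "(\<Sum>i\<in>S. x i + k * sum x S * (w i - v i))
      = sum x S + sum x S * (k * sum w S) - sum x S * (k * sum v S)"
    by (simp add: sum.distrib sum_subtractf algebra_simps flip: sum_distrib_left sum_distrib_right)
  also have "[sum x S + sum x S * (k * sum w S) - sum x S * (k * sum v S)
      = sum x S + sum x S * (k * sum w S) - sum x S * 1] (mod ?m)"
    by (intro cong_diff cong_mult k cong_refl)
  finally have "[l * sum ?y S = l * (sum x S * (k * sum w S))] (mod ?m)"
    by (intro cong_mult cong_refl) simp
  also have "l * (sum x S * (k * sum w S)) = k * sum x S * (l * sum w S)"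
    by (simp add: algebra_simps)
  also have "[k * sum x S * (l * sum w S) = k * sum x S * 1] (mod ?m)"
    by (intro cong_mult l cong_refl)
  finally have f: "[l * sum ?y S = k * sum x S] (mod ?m)" by simp
  have "(?y i + l * sum ?y S * (v i - w i)) mod ?m = x i" if i: "i < n" for i
  proof -
    have "[?y i + l * sum ?y S * (v i - w i)
        = (x i + k * sum x S * (w i - v i)) + k * sum x S * (v i - w i)] (mod ?m)"
      using i x by (intro cong_add cong_mult f cong_refl) (simp add: rank_one_update_def cong_def)
    also have "(x i + k * sum x S * (w i - v i)) + k * sum x S * (v i - w i) = x i"
      by (simp add: algebra_simps)
    finally show ?thesis
      using Zmod_power_mod[OF x i] by (simp add: cong_def)
  qed
  then have "rank_one_update p n S l (\<lambda>i. v i - w i) ?y i = x i" for i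
    using y PiE_arb[OF x[unfolded carrier_Zmod_power], of i]
    by (cases "i < n") (simp_all add: rank_one_update_def)
  then show ?thesis by (rule ext)
qed

lemma rank_one_update_auto:
  assumes "p > 1" and S: "S \<subseteq> {..<n}"
    and k: "[k * sum v S = 1] (mod int p)" and l: "[l * sum w S = 1] (mod int p)"
  shows "rank_one_update p n S k (\<lambda>i. w i - v i) \<in> auto (Zmod_power p n)"
proof -
  have "bij_betw (rank_one_update p n S k (\<lambda>i. w i - v i))
      (carrier (Zmod_power p n)) (carrier (Zmod_power p n))"
    by (rule bij_betw_byWitness[where f' = "rank_one_update p n S l (\<lambda>i. v i - w i)"])
      (auto simp: rank_one_update_inverse[OF assms(1) S _ k l]
        rank_one_update_inverse[OF assms(1) S _ l k] rank_one_update_closed[OF assms(1)])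
  then show ?thesis
    using rank_one_update_hom[OF assms(1) S]
    by (simp add: auto_def Bij_def rank_one_update_def)
qed

lemma rank_one_update_maps:
  assumes v: "v \<in> carrier (Zmod_power p n)" and w: "w \<in> carrier (Zmod_power p n)"
    and k: "[k * sum v S = 1] (mod int p)"
  shows "rank_one_update p n S k (\<lambda>i. w i - v i) v = w"
proof
  fix i
  have "(v i + k * sum v S * (w i - v i)) mod int p = w i" if i: "i < n"
  proof -
    have "[v i + k * sum v S * (w i - v i) = v i + 1 * (w i - v i)] (mod int p)"
      by (intro cong_add cong_mult k cong_refl)
    then show ?thesis
      using Zmod_power_mod[OF w i] by (simp add: cong_def)
  qed
  then show "rank_one_update p n S k (\<lambda>i. w i - v i) v i = w i"
    using v PiE_arb[OF w[unfolded carrier_Zmod_power], of i]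
    by (cases "i < n") (simp_all add: rank_one_update_def)
qed

section \<open>Transitivity on nonzero vectors\<close>

lemma Zmod_power_nonzero_coordinate:
  assumes x: "x \<in> carrier (Zmod_power p n)" and "x \<noteq> \<one>\<^bsub>Zmod_power p n\<^esub>"
  obtains i where "i < n" and "\<not> int p dvd x i"
proof -
  have "\<exists>i<n. x i \<noteq> 0"
  proof (rule ccontr)
    assume "\<not> (\<exists>i<n. x i \<noteq> 0)"
    then have "x = (\<lambda>i\<in>{..<n}. 0)"
      using x by (intro ext) (auto simp: carrier_Zmod_power PiE_iff extensional_def)
    then show False using assms(2) by (simp add: one_Zmod_power)
  qed
  then obtain i where "i < n" "x i \<noteq> 0" by blast
  then show ?thesis
    using that Zmod_power_mod[OF x, of i] by (auto simp: dvd_eq_mod_eq_0)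
qed

text \<open>If \<open>v\<close> and \<open>w\<close> share a nonzero coordinate, that coordinate will do. Otherwise a nonzero
  coordinate \<open>i\<close> of \<open>v\<close> is zero for \<open>w\<close> and a nonzero coordinate \<open>j\<close> of \<open>w\<close> is zero for \<open>v\<close>,
  and the sum of these two coordinates is \<open>v\<^sub>i\<close> at \<open>v\<close> and \<open>w\<^sub>j\<close> at \<open>w\<close>.\<close>

lemma coordinate_sum_nonzero_at_both:
  fixes v w :: "nat \<Rightarrow> int" and m :: int
  assumes i: "i < n" "\<not> m dvd v i" and j: "j < n" "\<not> m dvd w j"
  obtains S where "S \<subseteq> {..<n}" and "\<not> m dvd sum v S" and "\<not> m dvd sum w S"
proof (cases "m dvd w i \<and> m dvd v j")
  case True
  then have "i \<noteq> j" using i by blast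
  then show ?thesis
    using True i j that[of "{i, j}"] by (simp add: dvd_add_right_iff dvd_add_left_iff)
next
  case False
  then show ?thesis
    using i j that[of "{i}"] that[of "{j}"] by auto
qed

lemma inverse_mod_prime:
  fixes a :: int
  assumes "prime p" and "\<not> int p dvd a"
  obtains k where "[k * a = 1] (mod int p)"
proof -
  have "coprime a (int p)"
    using assms prime_imp_coprime[of "int p" a] by (simp add: coprime_commute)
  then show ?thesis
    using that cong_solve_coprime_int[of a "int p"] by (auto simp: mult.commute)
qed

theorem theorem6p4:
  fixes p n :: nat and u :: int and \<phi> :: "(nat \<Rightarrow> int) \<Rightarrow> (nat \<Rightarrow> int)"
  assumes "prime p" and "n \<ge> 1"
    and "\<phi> \<in> auto (Zmod_power p n)"
    and "u \<in> Units (residue_ring (int p))" and "u \<noteq> \<one>\<^bsub>residue_ring (int p)\<^esub>"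
    and "\<And>x. x \<in> carrier (Zmod_power p n) \<Longrightarrow>
      \<phi> x = (\<lambda>i\<in>{..<n}. u \<otimes>\<^bsub>residue_ring (int p)\<^esub> x i)"
  shows "doubly_transitive_action (QuandleAutoGroup (Alex (Zmod_power p n) \<phi>))
    (carrier (Alex (Zmod_power p n) \<phi>)) (\<lambda>f. f)"
proof (rule doubly_transitive_if_centralizer_transitive)
  have p: "p > 1" by (rule prime_gt_1_nat) fact
  then show "comm_group (Zmod_power p n)" by (rule comm_group_Zmod_power)
  show "\<phi> \<in> auto (Zmod_power p n)" by fact
  have phi: "\<phi> x = (\<lambda>i\<in>{..<n}. (u * x i) mod int p)" if "x \<in> carrier (Zmod_power p n)" for x
    using assms(6)[OF that] by (simp add: residue_ring_def)
  have phi_closed: "\<phi> x \<in> carrier (Zmod_power p n)" if "x \<in> carrier (Zmod_power p n)" for x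
    using assms(3) that by (auto simp: auto_def hom_def)
  fix v w
  assume v: "v \<in> carrier (Zmod_power p n)" "v \<noteq> \<one>\<^bsub>Zmod_power p n\<^esub>"
    and w: "w \<in> carrier (Zmod_power p n)" "w \<noteq> \<one>\<^bsub>Zmod_power p n\<^esub>"
  obtain i j where "i < n" "\<not> int p dvd v i" "j < n" "\<not> int p dvd w j"
    using Zmod_power_nonzero_coordinate v w by metis
  then obtain S where S: "S \<subseteq> {..<n}" "\<not> int p dvd sum v S" "\<not> int p dvd sum w S"
    by (rule coordinate_sum_nonzero_at_both)
  obtain k l where k: "[k * sum v S = 1] (mod int p)" and l: "[l * sum w S = 1] (mod int p)"
    using inverse_mod_prime[OF assms(1)] S by metis
  let ?\<psi> = "rank_one_update p n S k (\<lambda>i. w i - v i)"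
  have "?\<psi> (\<phi> x) = \<phi> (?\<psi> x)" if x: "x \<in> carrier (Zmod_power p n)" for x
    using rank_one_update_scalar[OF S(1) x] phi_closed[OF x]
    by (simp add: phi x rank_one_update_closed[OF p])
  then show "\<exists>\<psi>\<in>auto (Zmod_power p n).
      (\<forall>x\<in>carrier (Zmod_power p n). \<psi> (\<phi> x) = \<phi> (\<psi> x)) \<and> \<psi> v = w"
    using rank_one_update_auto[OF p S(1) k l] rank_one_update_maps[OF v(1) w(1) k] by blast
qed

end
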